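(* For every integer $d\ge 3$ and every real $\alpha\in[0,d]$, $g_\alpha(d)\ge d-\lceil\alpha\rceil\,\ln^2 d$, where $\ln^2 d=(\ln d)^2$.
   Context: A convex body $B\subset\mathbb{R}^d$ is a compact convex set with non-empty interior. For real $\alpha\ge 0$, $$g_\alpha(B)=\inf\left\{\sum_{i=1}^k \lambda_i^\alpha : k\in\mathbb{N},\ B\subseteq \bigcup_{i=1}^k(\lambda_i B+x_i),\ \lambda_i\in(0,1),\ x_i\in\mathbb{R}^d\right\},$$ and $g_\alpha(d)=\inf\{g_\alpha(B): B\subset\mathbb{R}^d,\ B \text{ is a convex body}\}$. *)

theory Defs
  imports "HOL-Analysis.Analysis"
begin

definition convex_body :: "(real ^ 'n) set \<Rightarrow> bool" where
  "convex_body B \<longleftrightarrow> compact B \<and> convex B \<and> interior B \<noteq> {}"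

(* The infima are taken in the extended reals, where they are meaningful without side conditions.
   Since every factor is positive, powr agrees with the usual power, with value 1 at exponent 0. *)
definition g_body :: "real \<Rightarrow> (real ^ 'n) set \<Rightarrow> ereal" where
  "g_body \<alpha> B = Inf {ereal (\<Sum>i<k. c i powr \<alpha>) | (k :: nat) (c :: nat \<Rightarrow> real) (x :: nat \<Rightarrow> real ^ 'n).
     (\<forall>i<k. c i \<in> {0<..<1}) \<and> B \<subseteq> (\<Union>i<k. (\<lambda>b. c i *\<^sub>R b + x i) ` B)}"

(* The dimension d is carried by the index type: d = CARD('n). *)
definition g_dim :: "'n::finite itself \<Rightarrow> real \<Rightarrow> ereal" where
  "g_dim _ \<alpha> = Inf {g_body \<alpha> B | B :: (real ^ 'n) set. convex_body B}"

end

theory Submission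
  imports Defs
begin

text \<open>
  Write \<open>c i\<close> for the ratios of the homothets that cover a convex body \<open>B\<close> in dimension \<open>d\<close>. The
  heart of the proof is that the covering stays expensive after large homothets are discarded: for
  every set \<open>S\<close> of \<open>n \<le> d\<close> homothets, the others satisfy \<open>\<Sum> c i ^ (d - n) \<ge> 1\<close>
  (\<open>cover_tail_sum_ge_1\<close>). For \<open>n = 0\<close> this compares volumes, and for \<open>n = d\<close> it says that more
  than \<open>d\<close> homothets are needed.

  The reason is a projection. Each homothet with ratio below 1 contracts \<open>B\<close> towards a fixed point.
  The \<open>n\<close> fixed points of the members of \<open>S\<close> lie in a common hyperplane, and \<open>B\<close> contains a point
  \<open>b0\<close> off it. Let \<open>W\<close> be the space spanned by the \<open>n\<close> directions from these fixed points to \<open>b0\<close>.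
  On every fibre of \<open>B\<close> parallel to \<open>W\<close>, the point farthest from the hyperplane on the side of
  \<open>b0\<close> lies in no member of \<open>S\<close>: otherwise it could be moved within its fibre further in that
  direction (\<open>fibre_point_outside_homothets\<close>). Hence the homothets outside \<open>S\<close> cover \<open>B\<close> modulo
  \<open>W\<close>, where the dimension is at least \<open>d - n\<close>, and a comparison of volumes there gives the claim.

  The rest concerns only the numbers \<open>c i\<close>. Since \<open>c i < 1\<close>, the exponent may be rounded up to
  \<open>k = \<lceil>\<alpha>\<rceil>\<close>. Discard the largest ratios one by one. When \<open>n\<close> are gone and \<open>d - n = m + k\<close>, the
  remaining sum \<open>T\<close> of \<open>k\<close>-th powers and its largest ratio \<open>r\<close> satisfy \<open>r ^ m * T \<ge> 1\<close>, so that
  \<open>r ^ k \<ge> 1 - k ln (m + 1) / m\<close> unless \<open>T\<close> is already at least \<open>m + 1\<close>. Summing over \<open>m\<close> bounds the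
  whole sum from below by \<open>d - k + 1 - k (\<Sum>j=1..d-k. ln (j + 1) / j)\<close> (\<open>tail_sum_ge\<close>). The
  logarithmic sum grows like half of \<open>(ln d)\<^sup>2\<close>, which leaves enough room for the lower order terms;
  the few small dimensions that remain are treated by hand (\<open>sum_power_ge_of_tails\<close>).
\<close>

section \<open>Discarding homothets by projection\<close>

text \<open>
  All fixed points \<open>z i\<close> of the discarded homothets lie in one hyperplane, because there are at most
  \<open>d\<close> of them. If a point \<open>p = c i b + (1 - c i) z i\<close> of the \<open>i\<close>-th one has \<open>b \<in> B\<close>, then replacing
  \<open>z i\<close> by \<open>b0 \<in> B\<close> gives another point of \<open>B\<close>, which differs from \<open>p\<close> by a multiple of \<open>b0 - z i\<close>
  and lies farther from the hyperplane. So the extreme point of a fibre is in none of them.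
\<close>
lemma fibre_point_outside_homothets:
  fixes B :: "(real ^ 'n) set"
  assumes "compact B" "convex B" "interior B \<noteq> {}"
    and "finite S" "card S \<le> CARD('n)" and c: "\<And>i. i \<in> S \<Longrightarrow> 0 < c i \<and> c i < 1"
  obtains W where "subspace W" "dim W \<le> card S"
    "\<And>q. q \<in> B \<Longrightarrow> \<exists>p\<in>B. p - q \<in> W \<and> (\<forall>i\<in>S. p \<notin> (\<lambda>b. c i *\<^sub>R b + x i) ` B)"
proof -
  define z where "z = (\<lambda>i. (1 / (1 - c i)) *\<^sub>R x i)"
  have z: "x i = (1 - c i) *\<^sub>R z i" if "i \<in> S" for i
    using c[OF that] by (simp add: z_def)
  have "aff_dim (z ` S) < DIM(real ^ 'n)"
    using aff_dim_le_card[of "z ` S"] card_image_le[OF \<open>finite S\<close>, of z] assms by simp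
  then obtain a s where "a \<noteq> 0" and as: "z ` S \<subseteq> {y. a \<bullet> y = s}"
    by (rule aff_lowdim_subset_hyperplane)
  have "\<not> B \<subseteq> {y. a \<bullet> y = s}"
    using \<open>interior B \<noteq> {}\<close> \<open>a \<noteq> 0\<close> interior_mono interior_hyperplane by blast
  then obtain b0 where b0: "b0 \<in> B" "a \<bullet> b0 \<noteq> s"
    by auto
  \<comment> \<open>The factor \<open>a \<bullet> b0 - s\<close> orients the normal so that it increases from every \<open>z i\<close> to \<open>b0\<close>.\<close>
  define u where "u = (a \<bullet> b0 - s) *\<^sub>R a"
  have u: "0 < u \<bullet> (b0 - z i)" if "i \<in> S" for i
  proof -
    have "u \<bullet> (b0 - z i) = (a \<bullet> b0 - s)\<^sup>2"
    proof -
      have "a \<bullet> z i = s"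
        using as that by auto
      then show ?thesis
        by (simp add: u_def inner_diff_right power2_eq_square right_diff_distrib)
    qed
    then show ?thesis
      using b0 by simp
  qed
  define W where "W = span ((\<lambda>i. b0 - z i) ` S)"
  show thesis
  proof (rule that[of W])
    show "subspace W"
      by (simp add: W_def)
    show "dim W \<le> card S"
      unfolding W_def dim_span
      using dim_le_card'[of "(\<lambda>i. b0 - z i) ` S"] card_image_le[OF \<open>finite S\<close>, of "\<lambda>i. b0 - z i"] \<open>finite S\<close>
      by simp
    fix q assume "q \<in> B"
    define F where "F = B \<inter> (+) q ` W"
    have "closed W"
      by (simp add: W_def closed_subspace)
    then have "compact F"
      unfolding F_def using \<open>compact B\<close> by (intro compact_Int_closed closed_translation)
    moreover have "q \<in> F"
      using \<open>q \<in> B\<close> subspace_0[OF \<open>subspace W\<close>] by (force simp: F_def)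
    ultimately obtain p where p: "p \<in> F" "\<And>y. y \<in> F \<Longrightarrow> u \<bullet> y \<le> u \<bullet> p"
      using continuous_attains_sup[of F "\<lambda>y. u \<bullet> y"] continuous_on_inner[OF continuous_on_const continuous_on_id] by blast
    have "p \<in> B" and pW: "p - q \<in> W"
      using p(1) by (auto simp: F_def)
    have "p \<notin> (\<lambda>b. c i *\<^sub>R b + x i) ` B" if iS: "i \<in> S" for i
    proof
      assume "p \<in> (\<lambda>b. c i *\<^sub>R b + x i) ` B"
      then obtain b where b: "b \<in> B" "p = c i *\<^sub>R b + (1 - c i) *\<^sub>R z i"
        using z[OF iS] by auto
      \<comment> \<open>Contracting \<open>b\<close> towards \<open>b0\<close> instead of \<open>z i\<close> stays in \<open>B\<close> by convexity.\<close>
      define p' where "p' = c i *\<^sub>R b + (1 - c i) *\<^sub>R b0"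
      have p': "p' = p + (1 - c i) *\<^sub>R (b0 - z i)"
        by (simp add: p'_def b algebra_simps)
      have "p' \<in> B"
        unfolding p'_def using \<open>convex B\<close> b b0 c[OF that] by (intro convexD) auto
      moreover have "(p - q) + (1 - c i) *\<^sub>R (b0 - z i) \<in> W"
        using pW that unfolding W_def by (intro span_add span_scale) (auto intro: span_base)
      then have "p' \<in> (+) q ` W"
        by (intro image_eqI[where x = "(p - q) + (1 - c i) *\<^sub>R (b0 - z i)"]) (auto simp: p')
      ultimately have "u \<bullet> p' \<le> u \<bullet> p"
        using p(2) by (simp add: F_def)
      moreover have "0 < (1 - c i) * (u \<bullet> (b0 - z i))"
        using u[OF that] c[OF that] by simp
      ultimately show False
        by (simp add: p' inner_add_right)
    qed
    then show "\<exists>p\<in>B. p - q \<in> W \<and> (\<forall>i\<in>S. p \<notin> (\<lambda>b. c i *\<^sub>R b + x i) ` B)"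
      using \<open>p \<in> B\<close> pW by blast
  qed
qed

text \<open>
  Straightening \<open>W\<close> turns the quotient modulo \<open>W\<close> into a choice of coordinates, so that volumes in
  dimension \<open>d - n\<close> can be computed inside the given space and no space of that dimension is needed.
\<close>
lemma linear_iso_into_coordinate_subspace:
  fixes W :: "(real ^ 'n) set"
  assumes "dim W \<le> card I"
  obtains f :: "real ^ 'n \<Rightarrow> real ^ 'n" where "linear f" "inj f" "\<And>w j. w \<in> W \<Longrightarrow> j \<notin> I \<Longrightarrow> f w $ j = 0"
proof -
  obtain C where C: "C \<subseteq> W" "independent C" "W \<subseteq> span C" "card C = dim W"
    using basis_exists by metis
  obtain D where D: "C \<subseteq> D" "independent D" "UNIV \<subseteq> span D"
    using maximal_independent_subset_extend[of C UNIV] C by auto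
  have fin: "finite D" "finite C"
    by (rule independent_imp_finite[OF D(2)], rule independent_imp_finite[OF C(2)])
  have cardD: "card D = CARD('n)"
    using D dim_eq_card_independent[of D] dim_span[of D] by (simp add: top.extremum_unique)
  obtain I0 where I0: "I0 \<subseteq> I" "card I0 = card C"
    using assms C(4) by (metis obtain_subset_with_card_n)
  have "card (D - C) = card (- I0)"
    using fin D(1) cardD I0 by (simp add: card_Diff_subset Compl_eq_Diff_UNIV)
  then obtain h2 where h2: "bij_betw h2 (D - C) (- I0)"
    using fin by (metis finite_Diff finite finite_same_card_bij)
  obtain h1 where h1: "bij_betw h1 C I0"
    using fin I0 by (metis finite finite_same_card_bij)
  define h where "h = (\<lambda>v. if v \<in> C then h1 v else h2 v)"
  have h: "h ` C = I0" "h ` D = UNIV"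
  proof -
    show "h ` C = I0"
      using h1 by (simp add: h_def bij_betw_def)
    moreover have "h ` (D - C) = - I0"
      using h2 by (auto simp: h_def bij_betw_def)
    ultimately show "h ` D = UNIV"
      using D(1) by (metis Compl_partition Un_Diff_cancel image_Un sup.absorb2)
  qed
  obtain f :: "real ^ 'n \<Rightarrow> real ^ 'n" where f: "linear f" "\<forall>v\<in>D. f v = axis (h v) 1"
    using linear_independent_extend[OF D(2), of "\<lambda>v. axis (h v) 1"] by blast
  have "range f = UNIV"
  proof -
    have "Basis \<subseteq> f ` D"
    proof
      fix e :: "real ^ 'n" assume "e \<in> Basis"
      then obtain j where e: "e = axis j 1"
        by (auto simp: Basis_vec_def)
      obtain v where "v \<in> D" "h v = j"
        using h(2) by (metis UNIV_I imageE)
      then show "e \<in> f ` D"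
        using f(2) e by force
    qed
    then have "span Basis \<subseteq> span (f ` D)"
      by (rule span_mono)
    then show ?thesis
      using linear_span_image[OF f(1), of D] by auto
  qed
  then have "inj f"
    using linear_surjective_imp_injective[OF f(1)] by simp
  moreover have "f w $ j = 0" if "w \<in> W" "j \<notin> I" for w j
  proof -
    have "subspace {v. f v $ j = 0}"
      unfolding subspace_def using f(1)
      by (simp add: linear_0 linear_add linear_scale)
    moreover have "C \<subseteq> {v. f v $ j = 0}"
    proof
      fix v assume v: "v \<in> C"
      then have "h v \<noteq> j"
        using h(1) I0(1) that(2) by blast
      then show "v \<in> {v. f v $ j = 0}"
        using f(2) D(1) v by (auto simp: axis_def)
    qed
    ultimately have "span C \<subseteq> {v. f v $ j = 0}"
      by (simp add: span_minimal)
    then show ?thesis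
      using C(3) that(1) by auto
  qed
  ultimately show thesis
    using that f(1) by blast
qed

text \<open>
  The hypothesis says that the projection of \<open>B\<close> to the coordinates in \<open>J\<close> is covered by the
  projections of homothets of \<open>B\<close>. To use Lebesgue measure of the full space, the projection is
  multiplied by a unit cube in the other coordinates. A homothet of the projection then corresponds
  to a diagonal map with entry \<open>c i\<close> on \<open>J\<close> and 1 elsewhere, whose determinant is \<open>c i ^ card J\<close>.
\<close>
lemma projected_cover_sum_ge_1:
  fixes B :: "(real ^ 'n) set"
  assumes "compact B" "interior B \<noteq> {}" "finite T" and c: "\<And>i. i \<in> T \<Longrightarrow> 0 < c i"
    and cover: "\<And>b. b \<in> B \<Longrightarrow> \<exists>i\<in>T. \<exists>b'\<in>B. \<forall>j\<in>J. b $ j = c i * b' $ j + y i $ j"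
  shows "1 \<le> (\<Sum>i\<in>T. c i ^ card J)"
proof -
  define g :: "real ^ 'n \<Rightarrow> real ^ 'n \<Rightarrow> real ^ 'n" where "g = (\<lambda>b t. \<chi> j. if j \<in> J then b $ j else t $ j)"
  define E where "E = (\<lambda>(b, t). g b t) ` (B \<times> cbox 0 1)"
  define m where "m = (\<lambda>i j. if j \<in> J then c i else 1)"
  define H where "H = (\<lambda>i. (\<lambda>v. \<chi> j. m i j * v $ j) ` E)"
  define y' :: "_ \<Rightarrow> real ^ 'n" where "y' = (\<lambda>i. \<chi> j. if j \<in> J then y i $ j else 0)"
  have "continuous_on (B \<times> cbox 0 1) (\<lambda>(b, t). g b t)"
    unfolding g_def case_prod_unfold
  proof (rule continuous_on_vec_lambda)
    show "continuous_on (B \<times> cbox 0 1) (\<lambda>p. if j \<in> J then fst p $ j else snd p $ j)" for j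
      by (cases "j \<in> J") (auto intro!: continuous_intros)
  qed
  then have "compact E"
    unfolding E_def using \<open>compact B\<close> by (intro compact_continuous_image compact_Times) auto
  then have E: "E \<in> lmeasurable"
    by (rule lmeasurable_compact)
  have H: "H i \<in> lmeasurable" "measure lebesgue (H i) = \<bar>prod (m i) UNIV\<bar> * measure lebesgue E" for i
    unfolding H_def using measurable_stretch[OF E] measure_stretch[OF E] by auto
  have prod: "\<bar>prod (m i) UNIV\<bar> = c i ^ card J" if "i \<in> T" for i
    using c[OF that] by (simp add: m_def prod.If_cases)
  have "E \<subseteq> (\<Union>i\<in>T. (+) (y' i) ` H i)"
  proof
    fix v assume "v \<in> E"
    then obtain b t where bt: "b \<in> B" "t \<in> cbox 0 1" "v = g b t"
      by (auto simp: E_def)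
    obtain i b' where i: "i \<in> T" "b' \<in> B" "\<forall>j\<in>J. b $ j = c i * b' $ j + y i $ j"
      using cover[OF bt(1)] by blast
    have "v = y' i + (\<chi> j. m i j * g b' t $ j)"
      using i(3) by (simp add: bt(3) g_def m_def y'_def vec_eq_iff)
    moreover have "g b' t \<in> E"
      using i(2) bt(2) by (auto simp: E_def)
    ultimately show "v \<in> (\<Union>i\<in>T. (+) (y' i) ` H i)"
      using i(1) unfolding H_def by blast
  qed
  moreover have "(\<Union>i\<in>T. (+) (y' i) ` H i) \<in> lmeasurable"
    using H(1) \<open>finite T\<close> by (intro fmeasurable.finite_UN measurable_translation)
  ultimately have "measure lebesgue E \<le> measure lebesgue (\<Union>i\<in>T. (+) (y' i) ` H i)"
    using E by (intro measure_mono_fmeasurable) auto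
  also have "\<dots> \<le> (\<Sum>i\<in>T. measure lebesgue ((+) (y' i) ` H i))"
    using H(1) \<open>finite T\<close> by (intro measure_UNION_le) (auto intro: fmeasurableD measurable_translation)
  also have "\<dots> = (\<Sum>i\<in>T. c i ^ card J) * measure lebesgue E"
    unfolding measure_translation sum_distrib_right using H(2) prod by (intro sum.cong) auto
  finally have le: "1 * measure lebesgue E \<le> (\<Sum>i\<in>T. c i ^ card J) * measure lebesgue E"
    by simp
  have "0 < measure lebesgue E"
  proof -
    obtain a where "a \<in> interior B"
      using \<open>interior B \<noteq> {}\<close> by auto
    then obtain l u where lu: "a \<in> box l u" "cbox l u \<subseteq> interior B"
      by (metis open_contains_cbox open_interior)
    then have B: "box l u \<subseteq> B"
      using box_subset_cbox interior_subset by blast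
    have "box (g l 0) (g u 1) \<subseteq> E"
    proof
      fix v assume v: "v \<in> box (g l 0) (g u 1)"
      have "g v a \<in> box l u"
        unfolding mem_box_cart
      proof
        show "l $ j < g v a $ j \<and> g v a $ j < u $ j" for j
          using v lu(1) by (cases "j \<in> J") (auto simp: mem_box_cart g_def dest: spec[of _ j])
      qed
      moreover have "g 0 v \<in> cbox 0 1"
        unfolding mem_box_cart
      proof
        show "0 $ j \<le> g 0 v $ j \<and> g 0 v $ j \<le> 1 $ j" for j
          using v by (cases "j \<in> J") (auto simp: mem_box_cart g_def dest: spec[of _ j])
      qed
      moreover have "v = g (g v a) (g 0 v)"
        by (simp add: g_def vec_eq_iff)
      ultimately show "v \<in> E"
        unfolding E_def using B by force
    qed
    moreover have "g a (\<chi> j. 1 / 2) \<in> box (g l 0) (g u 1)"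
      using lu(1) unfolding mem_box_cart g_def by auto
    ultimately have "\<not> negligible E"
      using open_not_negligible[of "box (g l 0) (g u 1)"] negligible_subset by blast
    then show ?thesis
      using E negligible_iff_measure zero_less_measure_iff by blast
  qed
  then show ?thesis
    using mult_right_le_imp_le[OF le] by simp
qed

text \<open>
  Each point of \<open>B\<close> agrees modulo \<open>W\<close> with a point that only homothets outside \<open>S\<close> can cover. After
  \<open>W\<close> is moved into \<open>card S\<close> of the coordinates, the remaining coordinates of the homothets outside
  \<open>S\<close> therefore cover those of \<open>B\<close>.
\<close>
lemma cover_tail_sum_ge_1:
  fixes B :: "(real ^ 'n) set"
  assumes B: "compact B" "convex B" "interior B \<noteq> {}"
    and "finite A" and c: "\<And>i. i \<in> A \<Longrightarrow> 0 < c i \<and> c i < 1"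
    and cover: "B \<subseteq> (\<Union>i\<in>A. (\<lambda>b. c i *\<^sub>R b + x i) ` B)"
    and "S \<subseteq> A" "card S \<le> CARD('n)"
  shows "1 \<le> (\<Sum>i\<in>A - S. c i ^ (CARD('n) - card S))"
proof -
  have "finite S"
    using \<open>S \<subseteq> A\<close> \<open>finite A\<close> by (rule finite_subset)
  then obtain W where "subspace W" "dim W \<le> card S"
    and W: "\<And>q. q \<in> B \<Longrightarrow> \<exists>p\<in>B. p - q \<in> W \<and> (\<forall>i\<in>S. p \<notin> (\<lambda>b. c i *\<^sub>R b + x i) ` B)"
    using fibre_point_outside_homothets[OF B, of S c x] assms by blast
  obtain I :: "'n set" where I: "card I = card S"
    using \<open>card S \<le> CARD('n)\<close> by (metis obtain_subset_with_card_n)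
  obtain f :: "real ^ 'n \<Rightarrow> real ^ 'n" where f: "linear f" "inj f"
    and fW: "\<And>w j. w \<in> W \<Longrightarrow> j \<notin> I \<Longrightarrow> f w $ j = 0"
    using linear_iso_into_coordinate_subspace[of W I] \<open>dim W \<le> card S\<close> I by metis
  have "1 \<le> (\<Sum>i\<in>A - S. c i ^ card (- I))"
  proof (rule projected_cover_sum_ge_1[where B = "f ` B" and y = "\<lambda>i. f (x i)"])
    show "compact (f ` B)"
      using B(1) f(1) by (intro compact_continuous_image linear_continuous_on) (simp add: linear_linear)
    show "interior (f ` B) \<noteq> {}"
      using B(3) f by (simp add: interior_injective_linear_image)
    fix v assume "v \<in> f ` B"
    then obtain q where "q \<in> B" and v: "v = f q"
      by blast
    then obtain p where p: "p \<in> B" "p - q \<in> W" "\<forall>i\<in>S. p \<notin> (\<lambda>b. c i *\<^sub>R b + x i) ` B"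
      using W by blast
    then obtain i b where i: "i \<in> A - S" "b \<in> B" "p = c i *\<^sub>R b + x i"
      using cover by blast
    have "v $ j = c i * f b $ j + f (x i) $ j" if "j \<in> - I" for j
    proof -
      have "f p $ j = v $ j"
        using fW[OF p(2)] that f(1) by (simp add: v linear_diff)
      then show ?thesis
        using f(1) by (simp add: i(3) linear_add linear_scale)
    qed
    then show "\<exists>i\<in>A - S. \<exists>b'\<in>f ` B. \<forall>j\<in>- I. v $ j = c i * b' $ j + f (x i) $ j"
      using i by blast
  qed (use \<open>finite A\<close> c in auto)
  then show ?thesis
    using I by (simp add: Compl_eq_Diff_UNIV card_Diff_subset)
qed

section \<open>From tail inequalities to power sums\<close>

text \<open>
  The index \<open>i\<close> is one of a largest ratio: all factors \<open>r j ^ m\<close> in the hypothesis are at most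
  \<open>r i ^ m\<close>.
\<close>
lemma tail_step:
  fixes r :: "'a \<Rightarrow> real"
  assumes "finite A" and "\<And>i. i \<in> A \<Longrightarrow> 0 < r i"
    and ge1: "1 \<le> (\<Sum>i\<in>A. r i ^ (m + k))"
  obtains i where "i \<in> A" and "(\<Sum>j\<in>A. r j ^ k) = (\<Sum>j\<in>A - {i}. r j ^ k) + r i ^ k"
    and "1 \<le> r i ^ m * (\<Sum>j\<in>A. r j ^ k)"
proof -
  have "A \<noteq> {}"
    using ge1 by auto
  then obtain i where i: "i \<in> A" "\<And>j. j \<in> A \<Longrightarrow> r j \<le> r i"
    using Max_in[of "r ` A"] Max_ge[of "r ` A"] \<open>finite A\<close> by fastforce
  have "(\<Sum>j\<in>A. r j ^ (m + k)) \<le> (\<Sum>j\<in>A. r i ^ m * r j ^ k)"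
    unfolding power_add using assms(2) i
    by (intro sum_mono mult_right_mono power_mono) (auto intro: less_imp_le)
  then have "1 \<le> r i ^ m * (\<Sum>j\<in>A. r j ^ k)"
    using ge1 by (simp add: sum_distrib_left)
  then show thesis
    using that[OF i(1)] sum.remove[OF \<open>finite A\<close> i(1), of "\<lambda>j. r j ^ k"] by (simp only: add.commute)
qed

text \<open>
  Quantifying over all sets \<open>S\<close> of the right size makes sorting superfluous: the induction step adds
  a largest remaining element to \<open>S\<close>. If the remaining sum is less than \<open>m + 1\<close>, that element \<open>r\<close>
  has \<open>r ^ m \<ge> 1 / (m + 1)\<close>, and \<open>exp t \<ge> 1 + t\<close> turns this into a lower bound for \<open>r ^ k\<close>.
  Using the bound \<open>m + 1\<close> on the current sum, rather than one on the whole sum, is what halves the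
  resulting \<open>(ln d)\<^sup>2\<close>.
\<close>
lemma tail_sum_ge:
  fixes r :: "'a \<Rightarrow> real"
  assumes "finite A" and pos: "\<And>i. i \<in> A \<Longrightarrow> 0 < r i"
    and tails: "\<And>S. S \<subseteq> A \<Longrightarrow> card S \<le> d \<Longrightarrow> 1 \<le> (\<Sum>i\<in>A - S. r i ^ (d - card S))"
  shows "S \<subseteq> A \<Longrightarrow> card S + m + k = d \<Longrightarrow>
    real m + 1 - real k * (\<Sum>j=1..m. ln (real j + 1) / real j) \<le> (\<Sum>i\<in>A - S. r i ^ k)"
proof (induction m arbitrary: S)
  case 0
  then have "d - card S = k"
    by simp
  with tails[of S] 0 show ?case
    by simp
next
  case (Suc m)
  let ?M = "Suc m"
  have fin: "finite (A - S)" and pos': "\<And>i. i \<in> A - S \<Longrightarrow> 0 < r i"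
    using \<open>finite A\<close> pos by auto
  have ge1: "1 \<le> (\<Sum>i\<in>A - S. r i ^ (?M + k))"
  proof -
    have "d - card S = ?M + k"
      using Suc.prems by simp
    with tails[of S] Suc.prems show ?thesis
      by simp
  qed
  then obtain i where i: "i \<in> A - S"
    and T: "(\<Sum>j\<in>A - S. r j ^ k) = (\<Sum>j\<in>A - S - {i}. r j ^ k) + r i ^ k"
    and le: "1 \<le> r i ^ ?M * (\<Sum>j\<in>A - S. r j ^ k)"
    using tail_step[OF fin pos' ge1] by blast
  have "card (insert i S) = Suc (card S)"
    using i finite_subset[OF Suc.prems(1) \<open>finite A\<close>] by simp
  then have "insert i S \<subseteq> A" "card (insert i S) + m + k = d"
    using Suc.prems i by auto
  moreover have "A - insert i S = A - S - {i}"
    by blast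
  ultimately have IH: "real m + 1 - real k * (\<Sum>j=1..m. ln (real j + 1) / real j) \<le> (\<Sum>j\<in>A - S - {i}. r j ^ k)"
    using Suc.IH[of "insert i S"] by presburger
  have "r i > 0"
    using pos i by simp
  show ?case
  proof (cases "real ?M + 1 \<le> (\<Sum>j\<in>A - S. r j ^ k)")
    case True
    have "0 \<le> real k * (\<Sum>j=1..?M. ln (real j + 1) / real j)"
      by (intro mult_nonneg_nonneg sum_nonneg) auto
    then show ?thesis
      using True by linarith
  next
    case False
    have "r i ^ ?M * (\<Sum>j\<in>A - S. r j ^ k) \<le> r i ^ ?M * (real ?M + 1)"
      using False \<open>r i > 0\<close> by (intro mult_left_mono) auto
    with le have "1 \<le> r i ^ ?M * (real ?M + 1)"
      by (rule order_trans)
    then have "0 \<le> ln (r i ^ ?M * (real ?M + 1))"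
      by simp
    also have "\<dots> = real ?M * ln (r i) + ln (real ?M + 1)"
      using \<open>r i > 0\<close> by (subst ln_mult) (auto simp: ln_realpow simp del: power_Suc)
    finally have "- (ln (real ?M + 1) / real ?M) \<le> ln (r i)"
      by (simp add: field_simps)
    then have "real k * - (ln (real ?M + 1) / real ?M) \<le> real k * ln (r i)"
      by (intro mult_left_mono) auto
    moreover have "1 + real k * ln (r i) \<le> exp (real k * ln (r i))"
      by (rule exp_ge_add_one_self)
    moreover have "exp (real k * ln (r i)) = r i ^ k"
      using \<open>r i > 0\<close> by (metis exp_ln exp_of_nat_mult)
    ultimately have "1 - real k * (ln (real ?M + 1) / real ?M) \<le> r i ^ k"
      by linarith
    then show ?thesis
      using IH T by (simp add: algebra_simps)
  qed
qed

section \<open>Comparing a logarithmic sum with the squared logarithm\<close>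

text \<open>
  The right-hand side is about \<open>2 ln n / n\<close>, twice the left-hand side. Since the squared logarithm
  grows faster than the logarithmic sum, a comparison of the two only has to be checked at one
  starting value.
\<close>
lemma ln_squared_step:
  assumes "n \<ge> (3::nat)"
  shows "ln (real n + 1) / real n \<le> (ln (real n + 1))\<^sup>2 - (ln (real n))\<^sup>2"
proof -
  define L where "L = ln (real n + 1)"
  define D where "D = L - ln (real n)"
  have "L \<ge> 1"
  proof -
    have "exp 1 \<le> real n + 1"
      using exp_le assms by linarith
    then show ?thesis
      unfolding L_def using assms by (subst ln_ge_iff) auto
  qed
  have D: "1 / (real n + 1) \<le> D" "D \<le> 1 / real n"
  proof -
    have "ln (real n) - ln (real n + 1) = ln (real n / (real n + 1))"
      using assms by (simp add: ln_div)
    also have "\<dots> \<le> real n / (real n + 1) - 1"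
      using assms by (intro ln_le_minus_one) auto
    also have "\<dots> = - (1 / (real n + 1))"
      by (simp add: field_simps)
    finally show "1 / (real n + 1) \<le> D" 
      by (simp add: D_def L_def)
    have "ln (real n + 1) - ln (real n) = ln ((real n + 1) / real n)"
      using assms by (simp add: ln_div)
    also have "\<dots> \<le> (real n + 1) / real n - 1"
      using assms by (intro ln_le_minus_one) auto
    also have "\<dots> = 1 / real n"
      using assms by (simp add: field_simps)
    finally show "D \<le> 1 / real n" 
      by (simp add: D_def L_def)
  qed
  have "1 / real n \<le> 1"
    using assms by simp
  have "1 \<le> L * (real n - 1)"
    using \<open>L \<ge> 1\<close> assms mult_mono[of 1 L 1 "real n - 1"] by auto
  then have "(L + 1) / real n \<le> L"
    using assms by (simp add: field_simps)
  then have "L + L / real n \<le> 2 * L - 1 / real n"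
    by (simp add: add_divide_distrib)
  then have "1 / (real n + 1) * (L + L / real n) \<le> 1 / (real n + 1) * (2 * L - 1 / real n)"
    by (intro mult_left_mono) auto
  moreover have "1 / (real n + 1) * (L + L / real n) = L / real n"
  proof -
    have "L + L / real n = L / real n * (real n + 1)"
      using assms by (simp add: distrib_left)
    then show ?thesis
      by simp
  qed
  ultimately have "L / real n \<le> 1 / (real n + 1) * (2 * L - 1 / real n)"
    by simp
  \<comment> \<open>This product is \<open>L\<^sup>2 - (L - D)\<^sup>2\<close>, and the two bounds on \<open>D\<close> serve one factor each.\<close>
  also have "\<dots> \<le> D * (2 * L - D)"
    using D \<open>L \<ge> 1\<close> \<open>1 / real n \<le> 1\<close> by (intro mult_mono) (auto intro: order_trans[OF _ D(1)])
  also have "\<dots> = L\<^sup>2 - (ln (real n))\<^sup>2"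
    by (simp add: D_def algebra_simps power2_eq_square)
  finally show ?thesis
    by (simp add: L_def)
qed

lemma sum_ln_over_le_mono:
  assumes "3 \<le> a" "a \<le> n"
    and base: "C + (\<Sum>j=1..a-1. ln (real j + 1) / real j) \<le> (ln (real a))\<^sup>2"
  shows "C + (\<Sum>j=1..n-1. ln (real j + 1) / real j) \<le> (ln (real n))\<^sup>2"
  using \<open>a \<le> n\<close>
proof (induction n rule: dec_induct)
  case base
  then show ?case using assms by simp
next
  case (step n)
  have "{1..n} = insert n {1..n-1}"
    using step assms by auto
  then have "(\<Sum>j=1..n. ln (real j + 1) / real j) = (\<Sum>j=1..n-1. ln (real j + 1) / real j) + ln (real n + 1) / real n"
    using step assms by simp
  then show ?case
    using step ln_squared_step[of n] assms by (simp add: add.commute)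
qed

text \<open>
  Comparing integer powers with powers of 2 reduces numerical estimates to \<open>ln 2 \<ge> 2 / 3\<close>.
\<close>
lemma ln_via_ln2:
  assumes "0 < b" "0 < (x::nat)"
  shows "x ^ b \<le> 2 ^ a \<Longrightarrow> real b * ln (real x) \<le> real a * ln 2"
    and "2 ^ a \<le> x ^ b \<Longrightarrow> real a * ln 2 \<le> real b * ln (real x)"
proof -
  have *: "real b * ln (real x) = ln (real (x ^ b))" "real a * ln 2 = ln (real (2 ^ a))"
    using assms by (simp_all add: ln_realpow)
  show "x ^ b \<le> 2 ^ a \<Longrightarrow> real b * ln (real x) \<le> real a * ln 2"
    unfolding * using assms by (subst ln_le_cancel_iff) (auto simp del: of_nat_power)
  show "2 ^ a \<le> x ^ b \<Longrightarrow> real a * ln 2 \<le> real b * ln (real x)"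
    unfolding * using assms by (subst ln_le_cancel_iff) (auto simp del: of_nat_power)
qed

text \<open>
  This is the estimate needed for exponent \<open>k = 1\<close>. It fails at \<open>n = 3\<close>.
\<close>
lemma sum_ln_over_le:
  assumes "4 \<le> n"
  shows "(\<Sum>j=1..n-1. ln (real j + 1) / real j) \<le> (ln (real n))\<^sup>2"
proof -
  define x :: real where "x = ln 2"
  have x: "x \<ge> 2 / 3"
    using ln2_ge_two_thirds by (simp add: x_def)
  have "ln 3 \<le> 8 / 5 * x"
    using ln_via_ln2(1)[of 5 3 8] by (simp add: x_def)
  moreover have "ln 4 = 2 * x"
    using ln_realpow[of 2 2] by (simp add: x_def)
  moreover have "x * (5 / 3 + 4 / 5) \<le> x * (4 * x)"
    using x by (intro mult_left_mono) auto
  ultimately have "x + ln 3 / 2 + ln 4 / 3 \<le> (ln 4)\<^sup>2"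
    by (simp add: power2_eq_square)
  moreover have "{1..3::nat} = {1,2,3}"
    by auto
  ultimately have "0 + (\<Sum>j=1..4-1. ln (real j + 1) / real j) \<le> (ln (real 4))\<^sup>2"
    by (simp add: x_def)
  then show ?thesis
    using sum_ln_over_le_mono[of 4 n 0] assms by simp
qed

text \<open>
  For exponents \<open>k \<ge> 2\<close> the tail estimate loses up to \<open>k - 1\<close> in its constant term, hence the
  additional 1. The inequality fails at \<open>n = 7\<close> by a small margin.
\<close>
lemma one_add_sum_ln_over_le:
  assumes "8 \<le> n"
  shows "1 + (\<Sum>j=1..n-1. ln (real j + 1) / real j) \<le> (ln (real n))\<^sup>2"
proof -
  define x :: real where "x = ln 2"
  have x: "x \<ge> 2 / 3"
    using ln2_ge_two_thirds by (simp add: x_def)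
  have "ln 3 \<le> 8 / 5 * x" "ln 5 \<le> 7 / 3 * x" "ln 7 \<le> 3 * x"
    using ln_via_ln2(1)[of 5 3 8] ln_via_ln2(1)[of 3 5 7] ln_via_ln2(1)[of 1 7 3] by (simp_all add: x_def)
  moreover have "ln 4 = 2 * x" and ln8: "ln 8 = 3 * x" and "ln 6 = ln 3 + x"
    using ln_realpow[of 2 2] ln_realpow[of 2 3] ln_mult[of 3 2] by (simp_all add: x_def)
  moreover have "0 \<le> (x - 2 / 3) * (9 * x + 3 / 2)"
    using x by (intro mult_nonneg_nonneg) auto
  then have "1 + 9 / 2 * x \<le> (3 * x)\<^sup>2"
    by (simp add: power2_eq_square algebra_simps)
  ultimately have "1 + (x + ln 3 / 2 + ln 4 / 3 + ln 5 / 4 + ln 6 / 5 + ln 7 / 6 + ln 8 / 7) \<le> (3 * x)\<^sup>2"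
    using x by linarith
  then have "1 + (x + ln 3 / 2 + ln 4 / 3 + ln 5 / 4 + ln 6 / 5 + ln 7 / 6 + ln 8 / 7) \<le> (ln 8)\<^sup>2"
    by (simp only: ln8)
  moreover have "{1..7::nat} = {1,2,3,4,5,6,7}"
    by auto
  ultimately have "1 + (\<Sum>j=1..8-1. ln (real j + 1) / real j) \<le> (ln (real 8))\<^sup>2"
    by (simp add: x_def)
  then show ?thesis
    using sum_ln_over_le_mono[of 8 n 1] assms by simp
qed

text \<open>
  In these dimensions \<open>n - k (ln n)\<^sup>2 \<le> 1\<close> as soon as \<open>k \<ge> 2\<close>.
\<close>
lemma pred_le_two_ln_squared:
  assumes "3 \<le> n" "n < (8::nat)"
  shows "real n - 1 \<le> 2 * (ln (real n))\<^sup>2"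
proof -
  have sq: "real n - 1 \<le> 2 * (ln (real n))\<^sup>2" if "0 \<le> c" "c \<le> ln (real n)" "real n - 1 \<le> 2 * c\<^sup>2" for c
    using power_mono[OF that(2,1), of 2] that(3) by linarith
  have l2: "ln 2 \<ge> (2 / 3::real)"
    by (rule ln2_ge_two_thirds)
  consider "n = 3" | "n = 4" | "n = 5" | "n = 6" | "n = 7"
    using assms by linarith
  then show ?thesis
  proof cases
    case 1
    then show ?thesis
      using ln_via_ln2(2)[of 2 3 3] l2 by (intro sq[of 1]) auto
  next
    case 2
    then show ?thesis
      using ln_via_ln2(2)[of 1 4 2] l2 by (intro sq[of "4/3"]) (auto simp: power2_eq_square)
  next
    case 3
    then show ?thesis
      using ln_via_ln2(2)[of 4 5 9] l2 by (intro sq[of "3/2"]) (auto simp: power2_eq_square)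
  next
    case 4
    then show ?thesis
      using ln_via_ln2(2)[of 2 6 5] l2 by (intro sq[of "5/3"]) (auto simp: power2_eq_square)
  next
    case 5
    then show ?thesis
      using ln_via_ln2(2)[of 4 7 11] l2 by (intro sq[of "11/6"]) (auto simp: power2_eq_square)
  qed
qed

section \<open>The lower bound\<close>

text \<open>
  For \<open>d = 3\<close> and \<open>k = 1\<close> the logarithmic estimate is slightly too weak, and two applications of
  \<open>tail_step\<close> replace it: they give a tail sum of at least \<open>3 / 2\<close> and then a sum of at least 2. For
  \<open>d < 8\<close> and \<open>k \<ge> 2\<close> the trivial lower bound 1 suffices.
\<close>
lemma sum_power_ge_of_tails:
  fixes r :: "'a \<Rightarrow> real"
  assumes "finite A" and pos: "\<And>i. i \<in> A \<Longrightarrow> 0 < r i"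
    and tails: "\<And>S. S \<subseteq> A \<Longrightarrow> card S \<le> d \<Longrightarrow> 1 \<le> (\<Sum>i\<in>A - S. r i ^ (d - card S))"
    and "d \<ge> 3" and "k \<le> d"
  shows "real d - real k * (ln (real d))\<^sup>2 \<le> (\<Sum>i\<in>A. r i ^ k)"
proof -
  define F where "F = (\<lambda>m. \<Sum>j=1..m. ln (real j + 1) / real j)"
  have low: "real (d - k) + 1 - real k * F (d - k) \<le> (\<Sum>i\<in>A. r i ^ k)"
    using tail_sum_ge[OF \<open>finite A\<close> pos tails, of "{}" "d - k" k] \<open>k \<le> d\<close> by (simp add: F_def)
  have "F (d - k) \<le> F (d - 1)" if "k \<ge> 1"
    unfolding F_def using that by (intro sum_mono2) auto
  then have kF: "real k * F (d - k) \<le> real k * F (d - 1)"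
    by (cases "k = 0") (auto intro: mult_left_mono)
  consider "k = 0" | "d = 3" "k = 1" | "d \<ge> 4" "k = 1" | "d < 8" "k \<ge> 2" | "d \<ge> 8" "k \<ge> 2"
    using \<open>d \<ge> 3\<close> by linarith
  then show ?thesis
  proof cases
    case 1
    then show ?thesis
      using low by simp
  next
    case 2
    have "1 \<le> (\<Sum>j\<in>A. r j ^ (2 + 1))"
      using tails[of "{}"] 2 by simp
    then obtain i where i: "i \<in> A" "(\<Sum>j\<in>A. r j) = (\<Sum>j\<in>A - {i}. r j) + r i"
       "1 \<le> (r i)\<^sup>2 * (\<Sum>j\<in>A. r j)"
      using tail_step[of A r 2 1] \<open>finite A\<close> pos by auto
    have "1 \<le> (\<Sum>j\<in>A - {i}. r j ^ (1 + 1))"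
      using tails[of "{i}"] 2 i(1) by (simp add: numeral_2_eq_2)
    then obtain i' where i': "i' \<in> A - {i}" "(\<Sum>j\<in>A - {i}. r j) = (\<Sum>j\<in>A - {i} - {i'}. r j) + r i'"
       "1 \<le> r i' * (\<Sum>j\<in>A - {i}. r j)"
      using tail_step[of "A - {i}" r 1 1] \<open>finite A\<close> pos by auto
    have "card {i, i'} = 2"
      using i'(1) by (subst card_2_iff) auto
    then have "1 \<le> (\<Sum>j\<in>A - {i} - {i'}. r j)"
      using tails[of "{i, i'}"] 2 i(1) i'(1) by (simp add: Diff_insert2[symmetric] insert_commute)
    then have T1: "1 + r i' \<le> (\<Sum>j\<in>A - {i}. r j)"
      using i'(2) by simp
    have "3 / 2 \<le> (\<Sum>j\<in>A - {i}. r j)"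
    proof (rule ccontr)
      assume less: "\<not> ?thesis"
      then have "r i' \<le> 1 / 2"
        using T1 by simp
      then have "r i' * (\<Sum>j\<in>A - {i}. r j) \<le> 1 / 2 * (3 / 2)"
        using less T1 pos[of i'] i'(1) by (intro mult_mono) auto
      then show False
        using i'(3) by simp
    qed
    then have T0: "3 / 2 + r i \<le> (\<Sum>j\<in>A. r j)"
      using i(2) by simp
    have "2 \<le> (\<Sum>j\<in>A. r j)"
    proof (rule ccontr)
      assume less: "\<not> ?thesis"
      then have "(r i)\<^sup>2 \<le> (1 / 2)\<^sup>2"
        using T0 pos[of i] i(1) by (intro power_mono) auto
      then have "(r i)\<^sup>2 * (\<Sum>j\<in>A. r j) \<le> (1 / 2)\<^sup>2 * 2"
        using less T0 pos[of i] i(1) by (intro mult_mono) auto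
      then show False
        using i(3) by (simp add: power2_eq_square)
    qed
    then show ?thesis
      using pred_le_two_ln_squared[of 3] 2 by simp
  next
    case 3
    then show ?thesis
      using low sum_ln_over_le[of d] by (simp add: F_def of_nat_diff)
  next
    case 4
    have "real d - 1 \<le> 2 * (ln (real d))\<^sup>2"
      using pred_le_two_ln_squared[of d] 4 \<open>d \<ge> 3\<close> by simp
    also have "\<dots> \<le> real k * (ln (real d))\<^sup>2"
      using 4 by (intro mult_right_mono) auto
    finally have "real d - real k * (ln (real d))\<^sup>2 \<le> 1"
      by simp
    also have "\<dots> \<le> (\<Sum>i\<in>A. r i ^ k)"
    proof -
      have "d \<le> card A"
      proof (rule ccontr)
        assume "\<not> d \<le> card A"
        then show False using tails[of A] by simp
      qed
      then obtain S where "S \<subseteq> A" "card S = d - k"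
        by (meson diff_le_self obtain_subset_with_card_n order_trans)
      then have "1 \<le> (\<Sum>i\<in>A - S. r i ^ k)"
        using tails[of S] \<open>k \<le> d\<close> by simp
      also have "\<dots> \<le> (\<Sum>i\<in>A. r i ^ k)"
        using \<open>finite A\<close> pos by (intro sum_mono2) (auto intro: less_imp_le)
      finally show ?thesis .
    qed
    finally show ?thesis .
  next
    case 5
    have "real k * (1 + F (d - 1)) \<le> real k * (ln (real d))\<^sup>2"
      using one_add_sum_ln_over_le[of d] 5 by (intro mult_left_mono) (auto simp: F_def)
    then show ?thesis
      using low kF \<open>k \<le> d\<close> by (simp add: of_nat_diff algebra_simps)
  qed
qed

theorem theorem4:
  fixes d :: nat and \<alpha> :: real
  assumes "CARD('n::finite) = d" and "d \<ge> 3" and "0 \<le> \<alpha>" and "\<alpha> \<le> real d"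
  shows "g_dim TYPE('n) \<alpha> \<ge> ereal (real d - real_of_int \<lceil>\<alpha>\<rceil> * (ln (real d))\<^sup>2)"
proof -
  define k where "k = nat \<lceil>\<alpha>\<rceil>"
  have k: "real k = real_of_int \<lceil>\<alpha>\<rceil>" "k \<le> d" "\<alpha> \<le> real k"
    using \<open>0 \<le> \<alpha>\<close> \<open>\<alpha> \<le> real d\<close> by (auto simp: k_def ceiling_le_iff nat_le_iff)
  have bound: "real d - real k * (ln (real d))\<^sup>2 \<le> (\<Sum>i<N. c i powr \<alpha>)"
    if B: "convex_body B" and c: "\<forall>i<N. c i \<in> {0<..<1}"
      and cover: "B \<subseteq> (\<Union>i<N. (\<lambda>b. c i *\<^sub>R b + x i) ` B)"
    for B :: "(real ^ 'n) set" and N :: nat and c :: "nat \<Rightarrow> real" and x :: "nat \<Rightarrow> real ^ 'n"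
  proof -
    have B': "compact B" "convex B" "interior B \<noteq> {}"
      using B by (auto simp: convex_body_def)
    have c01: "0 < c i \<and> c i < 1" if "i \<in> {..<N}" for i
      using c that by auto
    have tails: "1 \<le> (\<Sum>i\<in>{..<N} - S. c i ^ (d - card S))" if "S \<subseteq> {..<N}" "card S \<le> d" for S
      using cover_tail_sum_ge_1[OF B' finite_lessThan c01 cover that(1)] that(2) assms(1) by simp
    have "real d - real k * (ln (real d))\<^sup>2 \<le> (\<Sum>i<N. c i ^ k)"
      using sum_power_ge_of_tails[OF finite_lessThan _ tails \<open>d \<ge> 3\<close> \<open>k \<le> d\<close>] c01 by blast
    also have "\<dots> \<le> (\<Sum>i<N. c i powr \<alpha>)"
    proof (rule sum_mono)
      fix i assume "i \<in> {..<N}"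
      then have i: "0 < c i" "c i < 1"
        using c01 by auto
      have "c i ^ k = c i powr real k"
        using i by (simp add: powr_realpow)
      also have "\<dots> \<le> c i powr \<alpha>"
        using i k(3) by (intro powr_mono') auto
      finally show "c i ^ k \<le> c i powr \<alpha>" .
    qed
    finally show ?thesis .
  qed
  show ?thesis
    unfolding g_dim_def g_body_def k(1)[symmetric]
    using bound by (intro Inf_greatest) (force intro!: Inf_greatest)
qed

end
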